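(* Let $\omega\in M^+(\Omega_o)$ be given. Then there exists $\tilde\omega\in M^+(\Omega_o)$ with $$\mathcal I(\omega)=\mathcal I(\tilde\omega),\qquad \|\tilde\omega\|_{M(\Omega_o)}\le\|\omega\|_{M(\Omega_o)},\qquad \#\operatorname{supp}\tilde\omega\le n(n+1)/2.$$ Additionally, if there exists an optimal solution to $(P_\beta)$, then there exists an optimal solution $\bar\omega_\beta$ of $(P_\beta)$ with $\#\operatorname{supp}\bar\omega_\beta\le n(n+1)/2$.
   Context: Let $n\in\mathbb N$, $\Omega\subset\mathbb R^d$ a bounded domain, $\Omega_o\subset\bar\Omega$ nonempty and closed (hence compact). $M(\Omega_o)=C(\Omega_o)^*$ is the space of regular signed Borel measures with duality pairing $\langle\cdot,\cdot\rangle$ and total variation norm; $M^+(\Omega_o)$ is the cone of positive measures; $\#\operatorname{supp}\omega$ is the cardinality of the support. $\operatorname{Sym}(n)$, $\operatorname{NND}(n)$, $\operatorname{PD}(n)$ are the symmetric, symmetric positive semidefinite, and symmetric positive definite real $n\times n$ matrices; $A\le_L B$ means $B-A\in\operatorname{NND}(n)$. Let $Q_{ad}\subset\mathbb R^n$ and let $S$ (the parameter-to-state map) be a map with values in $C(\Omega_o)$, continuously differentiable in a neighborhood of $Q_{ad}$; fix $\hat q\in Q_{ad}$ and let $\partial_kS[\hat q]\in C(\Omega_o)$, $k=1,\dots,n$, be its partial derivatives at $\hat q$. Define $\mathcal I:M(\Omega_o)\to\operatorname{Sym}(n)$ by $\mathcal I(\omega)_{kl}=\langle\partial_kS[\hat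 q]\,\partial_lS[\hat q],\omega\rangle$. Fix $\mathcal I_0\in\operatorname{NND}(n)$ and $\beta>0$. Let $\Psi:\operatorname{Sym}(n)\to\mathbb R\cup\{+\infty\}$ satisfy: (A1) $\{\Psi<\infty\}=\operatorname{PD}(n)$; (A2) $\Psi$ is continuously differentiable on $\operatorname{PD}(n)$; (A3) $\Psi\ge0$ on $\operatorname{NND}(n)$; (A4) $\Psi$ is lower semicontinuous and convex on $\operatorname{NND}(n)$; (A5) $N_1\le_LN_2\Rightarrow\Psi(N_1)\ge\Psi(N_2)$ for $N_1,N_2\in\operatorname{NND}(n)$. Problem $(P_\beta)$: minimize $F(\omega)=\Psi(\mathcal I(\omega)+\mathcal I_0)+\beta\|\omega\|_{M(\Omega_o)}$ over $\omega\in M^+(\Omega_o)$. An optimal solution is a minimizer with finite objective value. *)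

theory Defs
  imports "HOL-Analysis.Analysis"
begin

section \<open>Symmetric matrices and the Loewner order\<close>

definition Sym :: "(real^'n^'n) set"
  where "Sym = {A. transpose A = A}"

definition NND :: "(real^'n^'n) set"
  where "NND = {A \<in> Sym. \<forall>x. 0 \<le> x \<bullet> (A *v x)}"

definition PD :: "(real^'n^'n) set"
  where "PD = {A \<in> Sym. \<forall>x. x \<noteq> 0 \<longrightarrow> 0 < x \<bullet> (A *v x)}"

definition loewner_le :: "real^'n^'n \<Rightarrow> real^'n^'n \<Rightarrow> bool"  (infix "\<le>\<^sub>L" 50)
  where "A \<le>\<^sub>L B \<longleftrightarrow> B - A \<in> NND"


section \<open>Positive measures on a compact set\<close>

text \<open>Elements of the cone of positive measures are library measures whose space is \<open>K\<close>, whose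
  sigma-algebra is the Borel sigma-algebra of \<open>K\<close>, and which are finite and regular. Signed
  measures occur below only through this cone.\<close>

definition regular_measure :: "'a::topological_space measure \<Rightarrow> bool"
  where "regular_measure \<omega> \<longleftrightarrow> (\<forall>A\<in>sets \<omega>.
    emeasure \<omega> A = (SUP C\<in>{C. compact C \<and> C \<subseteq> A}. emeasure \<omega> C) \<and>
    emeasure \<omega> A = (INF V\<in>{V. openin (top_of_set (space \<omega>)) V \<and> A \<subseteq> V}. emeasure \<omega> V))"

definition pos_measures :: "'a::topological_space set \<Rightarrow> 'a measure set"
  where "pos_measures K =
    {\<omega>. sets \<omega> = sets (restrict_space borel K) \<and> finite_measure \<omega> \<and> regular_measure \<omega>}"

text \<open>The total variation of a set function \<open>\<nu>\<close> (possibly signed) on the Borel sets of \<open>K\<close>: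
  the supremum over finite measurable partitions.\<close>

definition total_variation :: "'a::topological_space set \<Rightarrow> ('a set \<Rightarrow> real) \<Rightarrow> real"
  where "total_variation K \<nu> =
    (SUP P\<in>{P. finite P \<and> P \<subseteq> sets (restrict_space borel K) \<and> partition_on K P}.
       \<Sum>A\<in>P. \<bar>\<nu> A\<bar>)"

definition measure_norm :: "'a::topological_space measure \<Rightarrow> real"
  where "measure_norm \<omega> = total_variation (space \<omega>) (measure \<omega>)"

definition msupp :: "'a::topological_space measure \<Rightarrow> 'a set"
  where "msupp \<omega> =
    {x \<in> space \<omega>. \<forall>V. openin (top_of_set (space \<omega>)) V \<and> x \<in> V \<longrightarrow> 0 < emeasure \<omega> V}"


section \<open>The parameter-to-state map\<close>

text \<open>An element of \<open>C(K)\<close> is a function that is \<open>continuous_on K\<close>; its values outside \<open>K\<close> are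
  irrelevant, and convergence in the supremum norm of \<open>C(K)\<close> is \<open>uniform_limit K\<close>.
  The predicate below says that \<open>S\<close>, as a \<open>C(K)\<close>-valued map, is continuously Frechet
  differentiable in an open neighbourhood of \<open>Q\<close>, and that \<open>S' q h\<close> is its derivative at \<open>q\<close> in
  direction \<open>h\<close>. The last conjunct is continuity of \<open>S'\<close> in operator norm. Boundedness of
  the linear map \<open>S' q\<close> is automatic in finite dimension.\<close>

definition C1_near ::
  "'b::topological_space set \<Rightarrow> 'a::euclidean_space set \<Rightarrow> ('a \<Rightarrow> 'b \<Rightarrow> real)
    \<Rightarrow> ('a \<Rightarrow> 'a \<Rightarrow> 'b \<Rightarrow> real) \<Rightarrow> bool"
  where "C1_near K Q S S' \<longleftrightarrow> (\<exists>U. open U \<and> Q \<subseteq> U \<and> (\<forall>q\<in>U.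
    continuous_on K (S q) \<and>
    (\<forall>h. continuous_on K (S' q h)) \<and>
    (\<forall>x\<in>K. linear (\<lambda>h. S' q h x)) \<and>
    uniform_limit K (\<lambda>h x. (S (q + h) x - S q x - S' q h x) / norm h) (\<lambda>x. 0) (at 0) \<and>
    uniform_limit (cball 0 1 \<times> K) (\<lambda>p (h, x). S' p h x) (\<lambda>(h, x). S' q h x) (at q)))"

definition partial :: "(real^'n \<Rightarrow> real^'n \<Rightarrow> 'b \<Rightarrow> real) \<Rightarrow> 'n \<Rightarrow> real^'n \<Rightarrow> 'b \<Rightarrow> real"
  where "partial S' k q = S' q (axis k 1)"

definition fisher ::
  "(real^'n \<Rightarrow> real^'n \<Rightarrow> 'b \<Rightarrow> real) \<Rightarrow> real^'n \<Rightarrow> 'b measure \<Rightarrow> real^'n^'n"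
  where "fisher S' q \<omega> = (\<chi> k l. \<integral>x. partial S' k q x * partial S' l q x \<partial>\<omega>)"


section \<open>The design criterion\<close>

text \<open>The derivative is taken relative to the linear space \<open>Sym\<close>. It is given as a
  functional on all matrices, of which only the restriction to \<open>Sym\<close> is determined; a continuous
  choice on \<open>Sym\<close> extends by composition with the symmetrization.\<close>

definition C1_on_PD :: "(real^'n^'n \<Rightarrow> ereal) \<Rightarrow> bool"
  where "C1_on_PD \<Psi> \<longleftrightarrow> (\<exists>D :: real^'n^'n \<Rightarrow> (real^'n^'n) \<Rightarrow>\<^sub>L real. continuous_on PD D \<and>
    (\<forall>A\<in>PD. ((\<lambda>B. real_of_ereal (\<Psi> B)) has_derivative blinfun_apply (D A)) (at A within Sym)))"

definition lsc_on :: "'a::topological_space set \<Rightarrow> ('a \<Rightarrow> ereal) \<Rightarrow> bool"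
  where "lsc_on X f \<longleftrightarrow> (\<forall>x\<in>X. f x \<le> Liminf (at x within X) f)"

text \<open>Note that \<open>0 * \<infinity> = 0\<close> in \<open>ereal\<close>.\<close>

definition ereal_convex_on :: "'a::real_vector set \<Rightarrow> ('a \<Rightarrow> ereal) \<Rightarrow> bool"
  where "ereal_convex_on X f \<longleftrightarrow> convex X \<and> (\<forall>x\<in>X. \<forall>y\<in>X. \<forall>u\<ge>0. \<forall>v\<ge>0. u + v = 1 \<longrightarrow>
    f (u *\<^sub>R x + v *\<^sub>R y) \<le> ereal u * f x + ereal v * f y)"


section \<open>The optimal design problem\<close>

definition objective ::
  "(real^'n^'n \<Rightarrow> ereal) \<Rightarrow> (real^'n \<Rightarrow> real^'n \<Rightarrow> 'b::topological_space \<Rightarrow> real) \<Rightarrow> real^'n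
    \<Rightarrow> real^'n^'n \<Rightarrow> real \<Rightarrow> 'b measure \<Rightarrow> ereal"
  where "objective \<Psi> S' q I\<^sub>0 \<beta> \<omega> = \<Psi> (fisher S' q \<omega> + I\<^sub>0) + ereal (\<beta> * measure_norm \<omega>)"

definition optimal_solution :: "'b::topological_space set \<Rightarrow> ('b measure \<Rightarrow> ereal) \<Rightarrow> 'b measure \<Rightarrow> bool"
  where "optimal_solution K F \<omega> \<longleftrightarrow>
    \<omega> \<in> pos_measures K \<and> \<bar>F \<omega>\<bar> \<noteq> \<infinity> \<and> (\<forall>\<nu>\<in>pos_measures K. F \<omega> \<le> F \<nu>)"

end

theory Submission
  imports Defs
begin

text \<open>The matrix \<open>\<I>(\<omega>)\<close> is the integral against \<open>\<omega>\<close> of the continuous map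
  \<open>f x = (\<partial>\<^sub>kS x * \<partial>\<^sub>lS x)\<^sub>k\<^sub>l\<close>, whose values are symmetric matrices. Two facts from finite-dimensional
  convexity therefore carry the proof.

  After normalization by the mass, the integral of \<open>f\<close> is a mean value of \<open>f\<close>, so it cannot be
  separated by a hyperplane from the convex hull of \<open>f ` K\<close>, which is compact
  (\<open>integral_in_closed_convex\<close>). Hence some finite combination of point masses has the same
  matrix and the same mass as \<open>\<omega>\<close> (\<open>integral_eq_finite_combination\<close>).

  Caratheodory's theorem for convex hulls would only reduce the number of points to
  \<open>dim Sym + 1\<close>. Here the mass is allowed to decrease, and this saves one point: a linear relation
  among the matrices \<open>f x\<close> can be oriented such that subtracting it from the weights does not
  increase their sum, so points can be removed as long as there are more than \<open>dim Sym\<close> of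
  them (\<open>conic_caratheodory_mass\<close>). Finally \<open>dim Sym \<le> n (n + 1) / 2\<close> (\<open>dim_Sym_le\<close>).

  The objective depends on the measure only through its matrix and, increasingly, through its norm.
  So the reduction of a minimizer is again a minimizer.\<close>

section \<open>Finite representation of integrals\<close>

text \<open>If the mean value lay outside \<open>C\<close>, integrating the strict inequality for a separating
  functional over the whole space would contradict its value at the mean.\<close>

lemma integral_in_closed_convex:
  fixes f :: "'b \<Rightarrow> 'a::euclidean_space"
  assumes M: "finite_measure M" and m: "measure M (space M) > 0"
    and f: "integrable M f" and C: "convex C" "closed C" "\<And>x. x \<in> space M \<Longrightarrow> f x \<in> C"
  shows "(1 / measure M (space M)) *\<^sub>R integral\<^sup>L M f \<in> C"
proof (rule ccontr)
  interpret finite_measure M by fact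
  let ?m = "measure M (space M)"
  assume "(1 / ?m) *\<^sub>R integral\<^sup>L M f \<notin> C"
  then obtain a b where sep: "a \<bullet> ((1 / ?m) *\<^sub>R integral\<^sup>L M f) < b" "\<forall>y\<in>C. a \<bullet> y > b"
    using separating_hyperplane_closed_point C(1,2) by blast
  have "?m * b = (\<integral>x. b \<partial>M)"
    by simp
  also have "\<dots> \<le> (\<integral>x. a \<bullet> f x \<partial>M)"
    using f C(3) sep(2) by (intro integral_mono) (auto intro: less_imp_le)
  also have "\<dots> = a \<bullet> integral\<^sup>L M f"
    using f by simp
  finally have "?m * b \<le> a \<bullet> integral\<^sup>L M f" .
  then show False
    using sep(1) m by (simp add: field_simps)
qed

lemma integrable_continuous_compact:
  fixes f :: "'b::topological_space \<Rightarrow> 'a::euclidean_space"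
  assumes "compact K" "continuous_on K f" "finite_measure M"
    and sets: "sets M = sets (restrict_space borel K)"
  shows "integrable M f"
proof -
  interpret finite_measure M by fact
  have "space M = K"
    using sets_eq_imp_space_eq[OF sets] by (simp add: space_restrict_space)
  moreover obtain B where "\<And>x. x \<in> K \<Longrightarrow> norm (f x) \<le> B"
    using compact_imp_bounded[OF compact_continuous_image[OF assms(2,1)]]
    by (auto simp: bounded_iff)
  moreover have "f \<in> borel_measurable M"
    using borel_measurable_continuous_on_restrict[OF assms(2)] sets
    by (simp cong: measurable_cong_sets)
  ultimately show ?thesis
    by (intro integrable_const_bound[of _ B]) auto
qed

text \<open>The points are chosen so that \<open>f\<close> is injective on them. The weights of a convex
  combination of values of \<open>f\<close> then become weights of points.\<close>

lemma integral_eq_finite_combination: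
  fixes f :: "'b::topological_space \<Rightarrow> 'a::euclidean_space"
  assumes K: "compact K" and f: "continuous_on K f"
    and M: "finite_measure M" and sets: "sets M = sets (restrict_space borel K)"
  obtains T c where "finite T" "T \<subseteq> K" "\<And>x. x \<in> T \<Longrightarrow> 0 \<le> c x"
    "sum c T = measure M (space M)" "(\<Sum>x\<in>T. c x *\<^sub>R f x) = integral\<^sup>L M f"
proof (cases "measure M (space M) = 0")
  case True
  interpret finite_measure M by fact
  have "emeasure M (space M) = 0"
    using True by (simp add: emeasure_eq_measure)
  then have "AE x in M. f x = 0"
    by (intro AE_I[of _ _ "space M"]) auto
  then have "integral\<^sup>L M f = 0"
    by (rule integral_eq_zero_AE)
  then show ?thesis
    using True by (intro that[of "{}"]) auto
next
  case False
  let ?m = "measure M (space M)"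
  have m: "?m > 0"
    using False measure_nonneg[of M "space M"] by linarith
  have space: "space M = K"
    using sets_eq_imp_space_eq[OF sets] by (simp add: space_restrict_space)
  have "compact (convex hull (f ` K))"
    by (intro compact_convex_hull compact_continuous_image f K)
  then have "(1 / ?m) *\<^sub>R integral\<^sup>L M f \<in> convex hull (f ` K)"
    by (intro integral_in_closed_convex M m integrable_continuous_compact[OF K f M sets])
       (auto simp: compact_imp_closed space intro: hull_inc)
  then obtain V u where V: "finite V" "V \<subseteq> f ` K" "\<forall>y\<in>V. 0 \<le> u y" "sum u V = 1"
      "(\<Sum>y\<in>V. u y *\<^sub>R y) = (1 / ?m) *\<^sub>R integral\<^sup>L M f"
    unfolding convex_hull_explicit by blast
  obtain T where T: "T \<subseteq> K" "inj_on f T" "V = f ` T"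
    using V(2) unfolding subset_image_inj by blast
  show ?thesis
  proof (rule that)
    show "finite T"
      using V(1) T by (simp add: finite_image_iff)
    show "0 \<le> ?m * u (f x)" if "x \<in> T" for x
      using V(3) T that by simp
    show "(\<Sum>x\<in>T. ?m * u (f x)) = ?m"
      using V(4) T by (simp add: sum.reindex sum_distrib_left[symmetric])
    have "(\<Sum>x\<in>T. (?m * u (f x)) *\<^sub>R f x) = ?m *\<^sub>R (\<Sum>y\<in>V. u y *\<^sub>R y)"
      using T by (simp add: sum.reindex scaleR_sum_right)
    then show "(\<Sum>x\<in>T. (?m * u (f x)) *\<^sub>R f x) = integral\<^sup>L M f"
      using V(5) m by simp
  qed (use T in simp)
qed

section \<open>Sparse conic combinations\<close>

text \<open>The points are counted, and not the values of \<open>f\<close>: two points with the same value already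
  give a relation.\<close>

lemma linear_relation_of_card_gt_dim:
  fixes f :: "'b \<Rightarrow> 'a::euclidean_space"
  assumes T: "finite T" and card: "card T > dim (f ` T)"
  obtains l where "(\<Sum>x\<in>T. l x *\<^sub>R f x) = 0" "\<exists>x\<in>T. l x \<noteq> 0"
proof (cases "inj_on f T")
  case True
  then have "dependent (f ` T)"
    using card independent_card_le_dim[of "f ` T" "f ` T"] by (auto simp: card_image)
  then obtain u where "\<exists>v\<in>f ` T. u v \<noteq> 0" "(\<Sum>v\<in>f ` T. u v *\<^sub>R v) = 0"
    using T by (auto simp: dependent_finite)
  then show ?thesis
    using True by (intro that[of "u \<circ> f"]) (auto simp: sum.reindex)
next
  case False
  then obtain x y where xy: "x \<in> T" "y \<in> T" "x \<noteq> y" "f x = f y"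
    by (auto simp: inj_on_def)
  let ?l = "\<lambda>z. (if z = x then 1 else 0) - (if z = y then 1 else 0) :: real"
  have "(\<Sum>z\<in>T. ?l z *\<^sub>R f z)
      = (\<Sum>z\<in>T. if z = x then f z else 0) - (\<Sum>z\<in>T. if z = y then f z else 0)"
    unfolding sum_subtractf[symmetric] by (intro sum.cong) (auto simp: algebra_simps)
  also have "\<dots> = 0"
    using T xy by simp
  finally show ?thesis
    using xy by (intro that[of ?l]) auto
qed

text \<open>The sum of the coefficients of a linear relation may be taken nonnegative, for otherwise all signs are
  changed. A nonzero relation then has a positive coefficient, so that moving the weights against it
  makes some weight vanish. The first such moment keeps all the weights nonnegative.\<close>

lemma conic_caratheodory_mass:
  fixes f :: "'b \<Rightarrow> 'a::euclidean_space"
  assumes "finite T" "\<And>x. x \<in> T \<Longrightarrow> 0 \<le> (c x :: real)"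
  shows "\<exists>T' c'. T' \<subseteq> T \<and> card T' \<le> dim (f ` T) \<and> (\<forall>x\<in>T'. 0 \<le> c' x)
    \<and> (\<Sum>x\<in>T'. c' x *\<^sub>R f x) = (\<Sum>x\<in>T. c x *\<^sub>R f x) \<and> sum c' T' \<le> sum c T"
  using assms
proof (induction T arbitrary: c rule: finite_psubset_induct)
  case (psubset T)
  note T = psubset.hyps and c = psubset.prems
  show ?case
  proof (cases "card T \<le> dim (f ` T)")
    case True
    then show ?thesis
      using c by (intro exI[of _ T] exI[of _ c]) auto
  next
    case False
    then obtain l0 where l0: "(\<Sum>x\<in>T. l0 x *\<^sub>R f x) = 0" "\<exists>x\<in>T. l0 x \<noteq> 0"
      using linear_relation_of_card_gt_dim[OF T, of f] by auto
    define l where "l = (if sum l0 T \<ge> 0 then l0 else (\<lambda>x. - l0 x))"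
    have l: "(\<Sum>x\<in>T. l x *\<^sub>R f x) = 0" "\<exists>x\<in>T. l x \<noteq> 0" "sum l T \<ge> 0"
      using l0 by (auto simp: l_def sum_negf)
    define P where "P = {x \<in> T. l x > 0}"
    have "P \<noteq> {}"
    proof
      assume "P = {}"
      then have le: "\<forall>x\<in>T. l x \<le> 0"
        by (auto simp: P_def not_less)
      then have "sum l T = 0"
        using l(3) sum_nonpos[of T l] by force
      then show False
        using le l(2) sum_nonneg_eq_0_iff[of T "\<lambda>x. - l x"] T by (auto simp: sum_negf)
    qed
    then obtain z where z: "z \<in> P" "\<And>x. x \<in> P \<Longrightarrow> c z / l z \<le> c x / l x"
      using ex_min_if_finite[of "(\<lambda>x. c x / l x) ` P"] T
      by (force simp: P_def not_less)
    \<comment> \<open>The largest step along \<open>- l\<close> that keeps all the weights nonnegative.\<close>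
    define t where "t = c z / l z"
    have t: "t \<ge> 0"
      using z(1) c by (auto simp: t_def P_def)
    define d where "d = (\<lambda>x. c x - t * l x)"
    have d: "d x \<ge> 0" if "x \<in> T" for x
    proof (cases "l x > 0")
      case True
      then show ?thesis
        using z(2)[of x] that by (simp add: P_def d_def t_def[symmetric] pos_le_divide_eq)
    next
      case False
      then show ?thesis
        using t c[OF that] mult_nonneg_nonpos[of t "l x"] by (simp add: d_def)
    qed
    have zT: "z \<in> T" and dz: "d z = 0"
      using z(1) by (auto simp: P_def d_def t_def)
    obtain T' c' where T': "T' \<subseteq> T - {z}" "card T' \<le> dim (f ` (T - {z}))" "\<forall>x\<in>T'. 0 \<le> c' x"
        "(\<Sum>x\<in>T'. c' x *\<^sub>R f x) = (\<Sum>x\<in>T - {z}. d x *\<^sub>R f x)" "sum c' T' \<le> sum d (T - {z})"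
      using psubset.IH[of "T - {z}" d] zT d by blast
    have "dim (f ` (T - {z})) \<le> dim (f ` T)"
      by (intro dim_subset) auto
    moreover have "(\<Sum>x\<in>T - {z}. d x *\<^sub>R f x) = (\<Sum>x\<in>T. c x *\<^sub>R f x)"
    proof -
      have "(\<Sum>x\<in>T - {z}. d x *\<^sub>R f x) = (\<Sum>x\<in>T. d x *\<^sub>R f x)"
        using dz by (simp add: sum.remove[OF T zT])
      also have "\<dots> = (\<Sum>x\<in>T. c x *\<^sub>R f x) - t *\<^sub>R (\<Sum>x\<in>T. l x *\<^sub>R f x)"
        by (simp add: d_def scaleR_diff_left sum_subtractf scaleR_sum_right)
      finally show ?thesis
        using l(1) by simp
    qed
    moreover have "sum d (T - {z}) \<le> sum c T"
    proof -
      have "sum d (T - {z}) = sum d T"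
        using dz by (simp add: sum.remove[OF T zT])
      also have "\<dots> = sum c T - t * sum l T"
        by (simp add: d_def sum_subtractf sum_distrib_left)
      finally show ?thesis
        using t l(3) by simp
    qed
    ultimately show ?thesis
      using T' by (intro exI[of _ T'] exI[of _ c']) auto
  qed
qed

section \<open>The dimension of the space of symmetric matrices\<close>

text \<open>A symmetric matrix is a function of the unordered pair of its indices. Unordered pairs, with
  repetition allowed, are the index sets of cardinality 1 or 2.\<close>

lemma dim_Sym_le: "dim (Sym :: (real^'n^'n) set) \<le> CARD('n) * (CARD('n) + 1) div 2"
proof -
  define U where "U = {B :: 'n set. card B = 1} \<union> {B. card B = 2}"
  define E :: "'n set \<Rightarrow> real^'n^'n" where "E = (\<lambda>B. \<chi> i j. if {i, j} = B then 1 else 0)"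
  have mem_U: "{i, j} \<in> U" for i j :: 'n
    by (cases "i = j") (auto simp: U_def)
  have "A \<in> span (E ` U)" if A: "A \<in> Sym" for A :: "real^'n^'n"
  proof -
    have sym: "A $ i $ j = A $ j $ i" for i j
    proof -
      have "transpose A $ i $ j = A $ i $ j"
        using A by (simp add: Sym_def)
      then show ?thesis
        by (simp add: transpose_def)
    qed
    \<comment> \<open>By symmetry the value does not depend on the order in which \<open>B\<close> is listed.\<close>
    define a where "a B = (SOME r. \<exists>i j. {i, j} = B \<and> r = A $ i $ j)" for B
    have a: "a {i, j} = A $ i $ j" for i j
      unfolding a_def by (rule some_equality) (auto simp: doubleton_eq_iff sym)
    have "(\<Sum>B\<in>U. a B *\<^sub>R E B) $ i $ j = A $ i $ j" for i j
    proof -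
      have "(\<Sum>B\<in>U. a B *\<^sub>R E B) $ i $ j = (\<Sum>B\<in>U. if {i, j} = B then a B else 0)"
        unfolding sum_component by (intro sum.cong) (auto simp: E_def)
      also have "\<dots> = a {i, j}"
        using mem_U[of i j] by (simp add: sum.delta')
      finally show ?thesis
        by (simp add: a)
    qed
    then have "A = (\<Sum>B\<in>U. a B *\<^sub>R E B)"
      by (simp add: vec_eq_iff)
    then show ?thesis
      by (auto intro!: span_sum span_scale intro: span_base)
  qed
  then have "dim (Sym :: (real^'n^'n) set) \<le> card (E ` U)"
    by (intro dim_le_card) auto
  also have "\<dots> \<le> card U"
    by (intro card_image_le) simp
  also have "\<dots> = CARD('n) + CARD('n) * (CARD('n) - 1) div 2"
  proof -
    have "card U = card {B :: 'n set. card B = 1} + card {B :: 'n set. card B = 2}"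
      unfolding U_def by (intro card_Un_disjoint) auto
    then show ?thesis
      using n_subsets[of "UNIV :: 'n set" 1] n_subsets[of "UNIV :: 'n set" 2]
      by (simp add: choose_two)
  qed
  also have "\<dots> = CARD('n) * (CARD('n) + 1) div 2"
  proof -
    have "m + m * (m - 1) div 2 = m * (m + 1) div 2" for m :: nat
      by (cases m) (auto simp: algebra_simps)
    then show ?thesis .
  qed
  finally show ?thesis .
qed

section \<open>Finitely supported measures\<close>

text \<open>A point measure is defined on the subsets of \<open>T\<close>. Pushing it forward along the inclusion gives
  it the Borel sets of \<open>K\<close> as its sigma-algebra.\<close>

definition discrete_measure :: "'b::topological_space set \<Rightarrow> 'b set \<Rightarrow> ('b \<Rightarrow> real) \<Rightarrow> 'b measure"
  where "discrete_measure K T c = distr (point_measure T c) (restrict_space borel K) (\<lambda>x. x)"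

lemma sets_discrete_measure [simp]:
  "sets (discrete_measure K T c) = sets (restrict_space borel K)"
  by (simp add: discrete_measure_def)

lemma space_discrete_measure [simp]: "space (discrete_measure K T c) = K"
  by (simp add: discrete_measure_def space_restrict_space)

lemma measurable_point_measure_restrict:
  "T \<subseteq> K \<Longrightarrow> (\<lambda>x. x) \<in> point_measure T c \<rightarrow>\<^sub>M restrict_space borel K"
  by (auto simp: measurable_def space_point_measure sets_point_measure space_restrict_space)

lemma emeasure_discrete_measure:
  assumes "finite T" "T \<subseteq> K" "\<And>x. x \<in> T \<Longrightarrow> 0 \<le> c x"
    and A: "A \<in> sets (restrict_space borel K)"
  shows "emeasure (discrete_measure K T c) A = ennreal (sum c (A \<inter> T))"
proof -
  note id = measurable_point_measure_restrict[OF assms(2), of c]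
  have "emeasure (discrete_measure K T c) A = emeasure (point_measure T c) (A \<inter> T)"
    unfolding discrete_measure_def by (simp add: emeasure_distr[OF id A] space_point_measure)
  also have "\<dots> = (\<Sum>x\<in>A \<inter> T. ennreal (c x))"
    using assms(1) by (intro emeasure_point_measure_finite) auto
  also have "\<dots> = ennreal (sum c (A \<inter> T))"
    using assms(3) by (intro sum_ennreal) auto
  finally show ?thesis .
qed

lemma integral_discrete_measure:
  fixes g :: "'b::topological_space \<Rightarrow> real"
  assumes "finite T" "T \<subseteq> K" "\<And>x. x \<in> T \<Longrightarrow> 0 \<le> c x" "continuous_on K g"
  shows "integral\<^sup>L (discrete_measure K T c) g = (\<Sum>x\<in>T. c x * g x)"
proof -
  have "integral\<^sup>L (discrete_measure K T c) g = integral\<^sup>L (point_measure T c) g"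
    unfolding discrete_measure_def
    by (intro integral_distr measurable_point_measure_restrict assms(2)
        borel_measurable_continuous_on_restrict assms(4))
  also have "\<dots> = (\<Sum>x\<in>T. c x *\<^sub>R g x)"
    using assms(1,3) by (rule lebesgue_integral_point_measure_finite)
  finally show ?thesis
    by simp
qed

lemma openin_imp_sets_restrict_borel:
  "openin (top_of_set K) V \<Longrightarrow> V \<in> sets (restrict_space borel K)"
  by (auto simp: openin_open sets_restrict_space)

text \<open>Both extrema in the definition of regularity are attained: a Borel set \<open>A\<close> has the same measure as its finite part \<open>A \<inter> T\<close>, and
  as the relatively open set \<open>K - (T - A)\<close>.\<close>

lemma discrete_measure_in_pos_measures:
  fixes K :: "'b::t1_space set"
  assumes T: "finite T" "T \<subseteq> K" and c: "\<And>x. x \<in> T \<Longrightarrow> 0 \<le> c x"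
  shows "discrete_measure K T c \<in> pos_measures K"
proof -
  let ?\<nu> = "discrete_measure K T c"
  note em = emeasure_discrete_measure[OF T c]
  have fin: "finite_measure ?\<nu>"
    using sets.top[of ?\<nu>] by (intro finite_measureI) (simp add: em)
  have "regular_measure ?\<nu>"
    unfolding regular_measure_def
  proof (intro ballI conjI)
    fix A assume A: "A \<in> sets ?\<nu>"
    have AK: "A \<subseteq> K"
      using sets.sets_into_space[OF A] by simp
    have inner: "A \<inter> T \<in> sets (restrict_space borel K)"
      using T AK by (auto simp: sets_restrict_space image_iff
          intro!: bexI[of _ "A \<inter> T"] borel_closed finite_imp_closed)
    show "emeasure ?\<nu> A = (SUP C\<in>{C. compact C \<and> C \<subseteq> A}. emeasure ?\<nu> C)"
    proof (rule antisym)
      have "emeasure ?\<nu> A = emeasure ?\<nu> (A \<inter> T)"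
        using A inner by (simp add: em Int_assoc)
      also have "\<dots> \<le> (SUP C\<in>{C. compact C \<and> C \<subseteq> A}. emeasure ?\<nu> C)"
        using T(1) by (intro SUP_upper) (auto intro: finite_imp_compact)
      finally show "emeasure ?\<nu> A \<le> \<dots>" .
      show "(SUP C\<in>{C. compact C \<and> C \<subseteq> A}. emeasure ?\<nu> C) \<le> emeasure ?\<nu> A"
        using A by (intro SUP_least emeasure_mono) auto
    qed
    let ?V = "K - (T - A)"
    have V_eq: "?V = K \<inter> - (T - A)" by auto
    have open_V: "openin (top_of_set K) ?V"
      unfolding V_eq using T(1) by (intro openin_open_Int open_Compl finite_imp_closed) auto
    show "emeasure ?\<nu> A = (INF V\<in>{V. openin (top_of_set (space ?\<nu>)) V \<and> A \<subseteq> V}. emeasure ?\<nu> V)"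
    proof (rule antisym)
      show "emeasure ?\<nu> A \<le> (INF V\<in>{V. openin (top_of_set (space ?\<nu>)) V \<and> A \<subseteq> V}. emeasure ?\<nu> V)"
        using openin_imp_sets_restrict_borel by (intro INF_greatest emeasure_mono) auto
      have "(INF V\<in>{V. openin (top_of_set (space ?\<nu>)) V \<and> A \<subseteq> V}. emeasure ?\<nu> V) \<le> emeasure ?\<nu> ?V"
        using open_V AK by (intro INF_lower) auto
      also have "?V \<inter> T = A \<inter> T"
        using T by auto
      then have "emeasure ?\<nu> ?V = emeasure ?\<nu> A"
        using A openin_imp_sets_restrict_borel[OF open_V] by (simp add: em)
      finally show "(INF V\<in>{V. openin (top_of_set (space ?\<nu>)) V \<and> A \<subseteq> V}. emeasure ?\<nu> V)
          \<le> emeasure ?\<nu> A" .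
    qed
  qed
  with fin show ?thesis
    by (simp add: pos_measures_def)
qed

text \<open>Points of \<open>T\<close> may carry weight zero, hence only an inclusion.\<close>

lemma msupp_discrete_measure_subset:
  fixes K :: "'b::t1_space set"
  assumes T: "finite T" "T \<subseteq> K" and c: "\<And>x. x \<in> T \<Longrightarrow> 0 \<le> c x"
  shows "msupp (discrete_measure K T c) \<subseteq> T"
proof (rule subsetI, rule ccontr)
  fix x assume x: "x \<in> msupp (discrete_measure K T c)" "x \<notin> T"
  have V: "openin (top_of_set K) (K \<inter> - T)"
    using T(1) by (intro openin_open_Int open_Compl finite_imp_closed)
  then have "K \<inter> - T \<in> sets (restrict_space borel K)"
    by (rule openin_imp_sets_restrict_borel)
  then have "emeasure (discrete_measure K T c) (K \<inter> - T) = 0"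
    by (simp add: emeasure_discrete_measure[OF T c] Int_assoc)
  moreover have "x \<in> K \<inter> - T"
    using x by (simp add: msupp_def)
  with x(1) V have "emeasure (discrete_measure K T c) (K \<inter> - T) > 0"
    unfolding msupp_def by simp
  ultimately show False
    by simp
qed

text \<open>On a positive measure all partitions give the same sum. The trivial partition \<open>{K}\<close> is one of
  them, because \<open>K\<close> is nonempty.\<close>

lemma measure_norm_eq_mass:
  assumes M: "M \<in> pos_measures K" and "K \<noteq> {}"
  shows "measure_norm M = measure M (space M)"
proof -
  have sets: "sets M = sets (restrict_space borel K)" and "finite_measure M"
    using M by (auto simp: pos_measures_def)
  interpret finite_measure M by fact
  have space: "space M = K"
    using sets_eq_imp_space_eq[OF sets] by (simp add: space_restrict_space)
  let ?P = "{P. finite P \<and> P \<subseteq> sets (restrict_space borel K) \<and> partition_on K P}"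
  have "(\<Sum>A\<in>P. \<bar>measure M A\<bar>) = measure M K" if "P \<in> ?P" for P
    using that sets finite_measure_finite_Union[of P "\<lambda>A. A"]
    by (auto simp: partition_on_def disjoint_family_on_def disjoint_def)
  moreover have "{K} \<in> ?P"
    using sets.top[of M] \<open>K \<noteq> {}\<close> by (auto simp: sets space partition_on_def)
  ultimately have "(SUP P\<in>?P. \<Sum>A\<in>P. \<bar>measure M A\<bar>) = (SUP P\<in>?P. measure M K)"
    by (intro SUP_cong) auto
  also have "\<dots> = measure M K"
    using \<open>{K} \<in> ?P\<close> by (intro cSUP_const) blast
  finally show ?thesis
    by (simp add: measure_norm_def total_variation_def space)
qed

theorem theorem3p8:
  fixes \<Omega> \<Omega>\<^sub>o :: "(real^'d) set"
    and Q_ad :: "(real^'n) set"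
    and q_hat :: "real^'n"
    and S :: "real^'n \<Rightarrow> real^'d \<Rightarrow> real"
    and S' :: "real^'n \<Rightarrow> real^'n \<Rightarrow> real^'d \<Rightarrow> real"
    and I\<^sub>0 :: "real^'n^'n"
    and \<beta> :: real
    and \<Psi> :: "real^'n^'n \<Rightarrow> ereal"
  assumes domain: "open \<Omega>" "connected \<Omega>" "\<Omega> \<noteq> {}" "bounded \<Omega>"
    and observation: "\<Omega>\<^sub>o \<subseteq> closure \<Omega>" "\<Omega>\<^sub>o \<noteq> {}" "closed \<Omega>\<^sub>o"
    and state_map: "C1_near \<Omega>\<^sub>o Q_ad S S'"
    and q_hat: "q_hat \<in> Q_ad"
    and I0: "I\<^sub>0 \<in> NND"
    and beta: "\<beta> > 0"
    and Psi_range: "\<forall>A\<in>Sym. \<Psi> A \<noteq> - \<infinity>"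
    and A1: "{A \<in> Sym. \<Psi> A < \<infinity>} = PD"
    and A2: "C1_on_PD \<Psi>"
    and A3: "\<forall>A\<in>NND. 0 \<le> \<Psi> A"
    and A4: "lsc_on NND \<Psi>" "ereal_convex_on NND \<Psi>"
    and A5: "\<forall>A\<in>NND. \<forall>B\<in>NND. A \<le>\<^sub>L B \<longrightarrow> \<Psi> B \<le> \<Psi> A"
  shows "(\<forall>\<omega>\<in>pos_measures \<Omega>\<^sub>o. \<exists>\<omega>'\<in>pos_measures \<Omega>\<^sub>o.
            fisher S' q_hat \<omega> = fisher S' q_hat \<omega>' \<and>
            measure_norm \<omega>' \<le> measure_norm \<omega> \<and>
            finite (msupp \<omega>') \<and> card (msupp \<omega>') \<le> CARD('n) * (CARD('n) + 1) div 2) \<and>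
         ((\<exists>\<omega>. optimal_solution \<Omega>\<^sub>o (objective \<Psi> S' q_hat I\<^sub>0 \<beta>) \<omega>) \<longrightarrow>
          (\<exists>\<omega>. optimal_solution \<Omega>\<^sub>o (objective \<Psi> S' q_hat I\<^sub>0 \<beta>) \<omega> \<and>
            finite (msupp \<omega>) \<and> card (msupp \<omega>) \<le> CARD('n) * (CARD('n) + 1) div 2))"
proof -
  let ?K = "\<Omega>\<^sub>o" and ?N = "CARD('n) * (CARD('n) + 1) div 2"
  have K: "compact ?K"
    using observation bounded_subset[OF bounded_closure[OF domain(4)] observation(1)]
    by (simp add: compact_eq_bounded_closed)
  have cont: "continuous_on ?K (partial S' k q_hat)" for k
    using state_map q_hat unfolding C1_near_def partial_def by blast
  define f :: "real^'d \<Rightarrow> real^'n^'n"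
    where "f x = (\<chi> k l. partial S' k q_hat x * partial S' l q_hat x)" for x
  have cont_f: "continuous_on ?K f"
    unfolding f_def by (intro continuous_intros cont)
  have Sym_f: "f x \<in> Sym" for x
    by (simp add: f_def Sym_def transpose_def vec_eq_iff mult.commute)
  have fisher_eq: "fisher S' q_hat \<omega> = integral\<^sup>L \<omega> f" if "\<omega> \<in> pos_measures ?K" for \<omega>
  proof -
    have int: "integrable \<omega> f"
      using that by (intro integrable_continuous_compact[OF K cont_f]) (auto simp: pos_measures_def)
    have "(\<integral>x. f x $ k $ l \<partial>\<omega>) = integral\<^sup>L \<omega> f $ k $ l" for k l
      by (intro integral_bounded_linear[OF _ int] bounded_linear_compose[OF bounded_linear_vec_nth]
          bounded_linear_vec_nth)
    then show ?thesis
      by (simp add: fisher_def vec_eq_iff f_def)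
  qed
  have reduce: "\<exists>\<omega>'\<in>pos_measures ?K. fisher S' q_hat \<omega> = fisher S' q_hat \<omega>' \<and>
      measure_norm \<omega>' \<le> measure_norm \<omega> \<and> finite (msupp \<omega>') \<and> card (msupp \<omega>') \<le> ?N"
    if \<omega>: "\<omega> \<in> pos_measures ?K" for \<omega>
  proof -
    obtain T c where T: "finite T" "T \<subseteq> ?K" "\<And>x. x \<in> T \<Longrightarrow> 0 \<le> c x"
        "sum c T = measure \<omega> (space \<omega>)" "(\<Sum>x\<in>T. c x *\<^sub>R f x) = integral\<^sup>L \<omega> f"
      using integral_eq_finite_combination[OF K cont_f, of \<omega>] \<omega> by (auto simp: pos_measures_def)
    obtain T' c' where T': "T' \<subseteq> T" "card T' \<le> dim (f ` T)" "\<forall>x\<in>T'. 0 \<le> c' x"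
        "(\<Sum>x\<in>T'. c' x *\<^sub>R f x) = (\<Sum>x\<in>T. c x *\<^sub>R f x)" "sum c' T' \<le> sum c T"
      using conic_caratheodory_mass[OF T(1), of c f] T(3) by blast
    have fin: "finite T'" "T' \<subseteq> ?K" and c': "\<And>x. x \<in> T' \<Longrightarrow> 0 \<le> c' x"
      using T T' finite_subset by auto
    let ?\<nu> = "discrete_measure ?K T' c'"
    have pos: "?\<nu> \<in> pos_measures ?K"
      by (rule discrete_measure_in_pos_measures[OF fin c'])
    have "fisher S' q_hat ?\<nu> = (\<Sum>x\<in>T'. c' x *\<^sub>R f x)"
      by (simp add: fisher_def vec_eq_iff sum_component f_def
          integral_discrete_measure[OF fin c'] continuous_on_mult cont)
    then have same: "fisher S' q_hat \<omega> = fisher S' q_hat ?\<nu>"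
      using T' T fisher_eq[OF \<omega>] by simp
    have "?K \<in> sets (restrict_space borel ?K)"
      using sets.top[of ?\<nu>] by simp
    then have "measure ?\<nu> ?K = sum c' T'"
      using fin c'
      by (simp add: measure_def emeasure_discrete_measure[OF fin c'] Int_absorb1 sum_nonneg)
    then have norm: "measure_norm ?\<nu> \<le> measure_norm \<omega>"
      using T T' by (simp add: measure_norm_eq_mass[OF _ observation(2)] pos \<omega>)
    have supp: "msupp ?\<nu> \<subseteq> T'"
      by (rule msupp_discrete_measure_subset[OF fin c'])
    have "card (msupp ?\<nu>) \<le> card T'"
      by (rule card_mono[OF fin(1) supp])
    also have "\<dots> \<le> dim (f ` T)"
      by (rule T')
    also have "\<dots> \<le> dim (Sym :: (real^'n^'n) set)"
      using Sym_f by (intro dim_subset) auto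
    also have "\<dots> \<le> ?N"
      by (rule dim_Sym_le)
    finally show ?thesis
      using pos same norm finite_subset[OF supp fin(1)] by blast
  qed
  let ?F = "objective \<Psi> S' q_hat I\<^sub>0 \<beta>"
  have "\<exists>\<omega>'. optimal_solution ?K ?F \<omega>' \<and> finite (msupp \<omega>') \<and> card (msupp \<omega>') \<le> ?N"
    if opt: "optimal_solution ?K ?F \<omega>" for \<omega>
  proof -
    obtain \<omega>' where \<omega>': "\<omega>' \<in> pos_measures ?K" "fisher S' q_hat \<omega> = fisher S' q_hat \<omega>'"
        "measure_norm \<omega>' \<le> measure_norm \<omega>" "finite (msupp \<omega>')" "card (msupp \<omega>') \<le> ?N"
      using reduce[of \<omega>] opt by (auto simp: optimal_solution_def)
    have "?F \<omega>' \<le> ?F \<omega>"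
      unfolding objective_def \<omega>'(2) using \<omega>'(3) beta by (intro add_left_mono) simp
    moreover have "?F \<omega> \<le> ?F \<omega>'"
      using opt \<omega>'(1) by (simp add: optimal_solution_def)
    ultimately have "?F \<omega>' = ?F \<omega>"
      by (rule antisym)
    then have "optimal_solution ?K ?F \<omega>'"
      using opt \<omega>'(1) by (simp add: optimal_solution_def)
    with \<omega>'(4,5) show ?thesis
      by blast
  qed
  with reduce show ?thesis
    by blast
qed

end
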